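(* For any $x\in\mathbb{R}^n$, the following hold: (i) $\mathcal{D}(x)$ and $\mathcal{D}^{t}(x)$ are closed for every $t>0$; (ii) $\mathcal{D}^{t_1}(x)\subset \mathcal{D}^{t_2}(x)$ for any $t_2>t_1>0$; (iii) $\mathcal{D}(x)=\bigcap_{t>0}\mathcal{D}^{t}(x)$, and so for all $t>0$, $e(\mathcal{D}(x),\mathcal{D}^{t}(x))=0$ and $\psi_p(x)\le \psi_p^t(x)$; (iv) $\mathcal{D}(x)=\lim_{t\downarrow 0}\mathcal{D}^{t}(x)$ in the Painlevé–Kuratowski sense.
   Context: Setting. $F,f:\mathbb{R}^n\times\mathbb{R}^m\to\mathbb{R}$, $G:\mathbb{R}^n\to\mathbb{R}^p$, $g:\mathbb{R}^n\times\mathbb{R}^m\to\mathbb{R}^q$ are twice continuously differentiable. Let $X=\{x\in\mathbb{R}^n: G(x)\le 0\}$ and $S(x)=\arg\min_y\{f(x,y): g(x,y)\le 0\}$. Standing assumptions: $S(x)\neq\varnothing$ if $x\in X$ and $S(x)=\varnothing$ otherwise; $f$ and $g_1,\dots,g_q$ are convex in $y$; Slater condition: for every $x\in X$ there is $y(x)\in\mathbb{R}^m$ with $g_i(x,y(x))<0$ for all $i$. Let $\mathcal{L}(x,y,u)=\nabla_y f(x,y)+\sum_{i=1}^q u_i\nabla_y g_i(x,y)$ and $\mathcal{D}(x)=\{(y,u)\in\mathbb{R}^{m+q}: \mathcal{L}(x,y,u)=0,\ u\ge 0,\ g(x,y)\le 0,\ u^\top g(x,y)=0\}$; for $t>0$,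 $\mathcal{D}^t(x)=\{(y,u)\in\mathbb{R}^{m+q}: \mathcal{L}(x,y,u)=0,\ u\ge 0,\ g(x,y)\le 0,\ -u_ig_i(x,y)\le t,\ i=1,\dots,q\}$, assumed nonempty throughout. Put $\psi_p(x)=\max_{(y,u)\in\mathcal{D}(x)}F(x,y)$ and $\psi_p^t(x)=\max_{(y,u)\in\mathcal{D}^t(x)}F(x,y)$ (optimal value functions; the value is understood as the supremum). Excess: $e(A,B)=\sup_{a\in A}d(a,B)$, $d(a,B)=\inf_{b\in B}\|a-b\|$, with $e(\varnothing,B)=0$ and $e(A,\varnothing)=+\infty$ if $A\ne\varnothing$. Painlevé–Kuratowski limits as $t\downarrow0$ of a family of sets $\Psi(t)$: $\limsup_{t\downarrow 0}\Psi(t)$ is the set of $z$ such that there exist $t_k\downarrow0$ and $z_k\to z$ with $z_k\in\Psi(t_k)$ for all $k$; $\liminf_{t\downarrow 0}\Psi(t)$ is the set of $z$ such that for all $t_k\downarrow0$ there exist $z_k\to z$ with $z_k\in\Psi(t_k)$ for all $k$. The limit exists and equals the common set if the two coincide. *)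

theory Defs
  imports "HOL-Analysis.Analysis"
begin

text \<open>
  Vectors in \<open>real ^ 'p\<close> are ordered componentwise by the library, so that \<open>G x \<le> 0\<close>
  means \<open>G x $ i \<le> 0\<close> for all \<open>i\<close>.  Products carry the Euclidean norm.
\<close>

definition twice_cont_diff ::
  "('a::real_normed_vector \<Rightarrow> 'b::real_normed_vector) \<Rightarrow> bool" where
  "twice_cont_diff h \<longleftrightarrow>
    (\<exists>(h' :: 'a \<Rightarrow> 'a \<Rightarrow>\<^sub>L 'b) (h'' :: 'a \<Rightarrow> 'a \<Rightarrow>\<^sub>L 'a \<Rightarrow>\<^sub>L 'b).
       (\<forall>z. (h has_derivative blinfun_apply (h' z)) (at z)) \<and>
       (\<forall>z. (h' has_derivative blinfun_apply (h'' z)) (at z)) \<and>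
       continuous_on UNIV h'')"

definition gradient :: "('a::real_inner \<Rightarrow> real) \<Rightarrow> 'a \<Rightarrow> 'a" where
  "gradient h y = (THE D. GDERIV h y :> D)"

definition upper_feasible :: "(real ^ 'n \<Rightarrow> real ^ 'p) \<Rightarrow> (real ^ 'n) set" where
  "upper_feasible G = {x. G x \<le> 0}"

definition lower_sol ::
  "((real ^ 'n) \<times> (real ^ 'm) \<Rightarrow> real) \<Rightarrow> ((real ^ 'n) \<times> (real ^ 'm) \<Rightarrow> real ^ 'q)
    \<Rightarrow> real ^ 'n \<Rightarrow> (real ^ 'm) set" where
  "lower_sol f g x = {y. is_arg_min (\<lambda>y. f (x, y)) (\<lambda>y. g (x, y) \<le> 0) y}"

definition lagr_grad ::
  "((real ^ 'n) \<times> (real ^ 'm) \<Rightarrow> real) \<Rightarrow> ((real ^ 'n) \<times> (real ^ 'm) \<Rightarrow> real ^ 'q)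
    \<Rightarrow> real ^ 'n \<Rightarrow> real ^ 'm \<Rightarrow> real ^ 'q \<Rightarrow> real ^ 'm" where
  "lagr_grad f g x y u =
    gradient (\<lambda>y. f (x, y)) y + (\<Sum>i\<in>UNIV. (u $ i) *\<^sub>R gradient (\<lambda>y. g (x, y) $ i) y)"

definition KKT_set ::
  "((real ^ 'n) \<times> (real ^ 'm) \<Rightarrow> real) \<Rightarrow> ((real ^ 'n) \<times> (real ^ 'm) \<Rightarrow> real ^ 'q)
    \<Rightarrow> real ^ 'n \<Rightarrow> ((real ^ 'm) \<times> (real ^ 'q)) set" where
  "KKT_set f g x =
    {(y, u). lagr_grad f g x y u = 0 \<and> 0 \<le> u \<and> g (x, y) \<le> 0 \<and> u \<bullet> g (x, y) = 0}"

definition relaxed_KKT_set ::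
  "((real ^ 'n) \<times> (real ^ 'm) \<Rightarrow> real) \<Rightarrow> ((real ^ 'n) \<times> (real ^ 'm) \<Rightarrow> real ^ 'q)
    \<Rightarrow> real \<Rightarrow> real ^ 'n \<Rightarrow> ((real ^ 'm) \<times> (real ^ 'q)) set" where
  "relaxed_KKT_set f g t x =
    {(y, u). lagr_grad f g x y u = 0 \<and> 0 \<le> u \<and> g (x, y) \<le> 0 \<and>
             (\<forall>i. - (u $ i) * (g (x, y) $ i) \<le> t)}"

text \<open>
  Optimal values are suprema in the extended reals: \<open>\<infinity>\<close> if the objective is unbounded above,
  \<open>-\<infinity>\<close> if the constraint set is empty.
\<close>

definition psi_p ::
  "((real ^ 'n) \<times> (real ^ 'm) \<Rightarrow> real) \<Rightarrow> ((real ^ 'n) \<times> (real ^ 'm) \<Rightarrow> real)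
    \<Rightarrow> ((real ^ 'n) \<times> (real ^ 'm) \<Rightarrow> real ^ 'q) \<Rightarrow> real ^ 'n \<Rightarrow> ereal" where
  "psi_p F f g x = (SUP (y, u)\<in>KKT_set f g x. ereal (F (x, y)))"

definition psi_p_relaxed ::
  "((real ^ 'n) \<times> (real ^ 'm) \<Rightarrow> real) \<Rightarrow> ((real ^ 'n) \<times> (real ^ 'm) \<Rightarrow> real)
    \<Rightarrow> ((real ^ 'n) \<times> (real ^ 'm) \<Rightarrow> real ^ 'q) \<Rightarrow> real \<Rightarrow> real ^ 'n \<Rightarrow> ereal" where
  "psi_p_relaxed F f g t x = (SUP (y, u)\<in>relaxed_KKT_set f g t x. ereal (F (x, y)))"

text \<open>
  The library's \<open>infdist\<close> is \<open>0\<close> for an empty set.  In \<open>ennreal\<close> the infimum over the empty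
  set is \<open>\<infinity>\<close> and the supremum over the empty set is \<open>0\<close>, so \<open>excess {} B = 0\<close>, and
  \<open>excess A {} = \<infinity>\<close> for nonempty \<open>A\<close>.
\<close>

definition edist_set :: "'a::real_normed_vector \<Rightarrow> 'a set \<Rightarrow> ennreal" where
  "edist_set a B = (INF b\<in>B. ennreal (norm (a - b)))"

definition excess :: "'a::real_normed_vector set \<Rightarrow> 'a set \<Rightarrow> ennreal" where
  "excess A B = (SUP a\<in>A. edist_set a B)"

text \<open>\<open>t\<^sub>k \<down> 0\<close> is read as convergence to \<open>0\<close> through positive values, not necessarily monotone.\<close>

definition down_to_zero :: "(nat \<Rightarrow> real) \<Rightarrow> bool" where
  "down_to_zero t \<longleftrightarrow> (\<forall>k. t k > 0) \<and> t \<longlonglongrightarrow> 0"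

definition PK_limsup :: "(real \<Rightarrow> 'a::topological_space set) \<Rightarrow> 'a set" where
  "PK_limsup \<Psi> =
    {z. \<exists>t zs. down_to_zero t \<and> zs \<longlonglongrightarrow> z \<and> (\<forall>k. zs k \<in> \<Psi> (t k))}"

definition PK_liminf :: "(real \<Rightarrow> 'a::topological_space set) \<Rightarrow> 'a set" where
  "PK_liminf \<Psi> =
    {z. \<forall>t. down_to_zero t \<longrightarrow> (\<exists>zs. zs \<longlonglongrightarrow> z \<and> (\<forall>k. zs k \<in> \<Psi> (t k)))}"

definition PK_converges :: "(real \<Rightarrow> 'a::topological_space set) \<Rightarrow> 'a set \<Rightarrow> bool" where
  "PK_converges \<Psi> L \<longleftrightarrow> PK_limsup \<Psi> = L \<and> PK_liminf \<Psi> = L"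

end

theory Submission
  imports Defs
begin

text \<open>
  Complementarity with signs \<open>u \<ge> 0\<close>, \<open>g \<le> 0\<close> forces every product \<open>u\<^sub>i g\<^sub>i\<close> to vanish, so the
  KKT set is the relaxed set at \<open>t = 0\<close>.  Partial gradients of a \<open>C\<^sup>1\<close> map are continuous, so all
  relaxed sets are closed; they increase with \<open>t\<close> and intersect in the KKT set, and any monotone
  family of closed sets converges to its intersection as \<open>t\<close> decreases to \<open>0\<close>.
\<close>

text \<open>\<open>gradient\<close> is a definite description, so nothing can be read off before
  existence and uniqueness are settled. Linearity of \<open>h'\<close> gives the representing
  vector, and uniqueness of derivatives does the rest. The explicit sum shows how the gradient
  varies with the base point.\<close>

lemma gradient_eq_sum_Basis:
  fixes h :: "'a::euclidean_space \<Rightarrow> real"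
  assumes "(h has_derivative h') (at y)"
  shows "gradient h y = (\<Sum>b\<in>Basis. h' b *\<^sub>R b)"
proof -
  interpret bounded_linear h'
    using assms by (rule has_derivative_bounded_linear)
  have "h' v = v \<bullet> (\<Sum>b\<in>Basis. h' b *\<^sub>R b)" for v
  proof -
    have "h' v = h' (\<Sum>b\<in>Basis. (v \<bullet> b) *\<^sub>R b)"
      by (simp add: euclidean_representation)
    also have "\<dots> = v \<bullet> (\<Sum>b\<in>Basis. h' b *\<^sub>R b)"
      by (simp add: sum scaleR inner_sum_right mult.commute)
    finally show ?thesis .
  qed
  then have "h' = (\<lambda>v. v \<bullet> (\<Sum>b\<in>Basis. h' b *\<^sub>R b))"
    by blast
  then have D: "GDERIV h y :> (\<Sum>b\<in>Basis. h' b *\<^sub>R b)"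
    using assms unfolding gderiv_def by simp
  moreover have "E = (\<Sum>b\<in>Basis. h' b *\<^sub>R b)" if "GDERIV h y :> E" for E
  proof -
    have "(\<lambda>v. v \<bullet> E) = (\<lambda>v. v \<bullet> (\<Sum>b\<in>Basis. h' b *\<^sub>R b))"
      using that D unfolding gderiv_def by (rule has_derivative_unique)
    then show ?thesis
      by (metis vector_eq_ldot)
  qed
  ultimately show ?thesis
    unfolding gradient_def by (rule the_equality)
qed

text \<open>Chain rule along the affine embedding of \<open>y\<close> as \<open>(x, y)\<close>. The
  map \<open>l\<close> lets one statement serve both \<open>f\<close> (identity) and the components
  of \<open>g\<close> (coordinate projections).\<close>

lemma continuous_on_partial_gradient:
  fixes h :: "'a::euclidean_space \<times> 'b::euclidean_space \<Rightarrow> 'c::real_normed_vector"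
  assumes "twice_cont_diff h" and l: "bounded_linear l"
  shows "continuous_on UNIV (gradient (\<lambda>y. l (h (x, y))))"
proof -
  obtain h' :: "'a \<times> 'b \<Rightarrow> ('a \<times> 'b) \<Rightarrow>\<^sub>L 'c" and h'' where
    h': "\<And>z. (h has_derivative blinfun_apply (h' z)) (at z)" and
    h'': "\<And>z. (h' has_derivative blinfun_apply (h'' z)) (at z)"
    using assms(1) unfolding twice_cont_diff_def by blast
  have "((\<lambda>y. l (h (x, y))) has_derivative (\<lambda>v. l (h' (x, y) (0, v)))) (at y)" for y
  proof -
    have "((\<lambda>y. (x, y)) has_derivative (\<lambda>v. (0, v))) (at y)"
      by (intro derivative_intros)
    from has_derivative_compose[OF this h'] show ?thesis
      by (rule bounded_linear.has_derivative[OF l])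
  qed
  then have grad: "gradient (\<lambda>y. l (h (x, y))) = (\<lambda>y. \<Sum>b\<in>Basis. l (h' (x, y) (0, b)) *\<^sub>R b)"
    by (auto intro!: gradient_eq_sum_Basis)
  have "continuous_on UNIV h'"
    using h'' by (meson continuous_at_imp_continuous_on has_derivative_continuous)
  then have "continuous_on UNIV (\<lambda>y. h' (x, y))"
    by (rule continuous_on_compose2) (auto intro!: continuous_intros)
  then show ?thesis
    unfolding grad
    by (intro continuous_intros bounded_linear.continuous_on[OF l])
qed

lemma twice_cont_diff_imp_continuous_on:
  assumes "twice_cont_diff h"
  shows "continuous_on A h"
  using assms unfolding twice_cont_diff_def
  by (meson continuous_at_imp_continuous_on has_derivative_continuous)

text \<open>Makes closedness and the inclusion in the relaxed sets instances of the facts about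
  \<open>relaxed_KKT_set\<close>.\<close>

lemma KKT_set_eq_relaxed_0: "KKT_set f g x = relaxed_KKT_set f g 0 x"
proof -
  have "u \<bullet> w = 0 \<longleftrightarrow> (\<forall>i. - (u $ i) * (w $ i) \<le> 0)" if "0 \<le> u" "w \<le> 0" for u w :: "real ^ 'q"
  proof -
    have np: "u $ i * w $ i \<le> 0" for i
      using that by (simp add: less_eq_vec_def mult_nonneg_nonpos)
    \<comment> \<open>The double negation produces a sum of nonnegative terms, which vanishes only
      if each term does.\<close>
    have "u \<bullet> w = - (\<Sum>i\<in>UNIV. - (u $ i * w $ i))"
      by (simp add: inner_vec_def sum_negf)
    then have "u \<bullet> w = 0 \<longleftrightarrow> (\<forall>i. u $ i * w $ i = 0)"
      using np by (simp add: sum_nonneg_eq_0_iff)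
    moreover have "u $ i * w $ i = 0 \<longleftrightarrow> - (u $ i) * (w $ i) \<le> 0" for i
      using np[of i] by linarith
    ultimately show ?thesis
      by simp
  qed
  then show ?thesis
    unfolding KKT_set_def relaxed_KKT_set_def by blast
qed

lemma closed_relaxed_KKT_set:
  fixes f :: "(real ^ 'n) \<times> (real ^ 'm) \<Rightarrow> real"
    and g :: "(real ^ 'n) \<times> (real ^ 'm) \<Rightarrow> real ^ 'q"
  assumes f: "twice_cont_diff f" and g: "twice_cont_diff g"
  shows "closed (relaxed_KKT_set f g t x)"
proof -
  have df: "continuous_on UNIV (\<lambda>z :: (real ^ 'm) \<times> (real ^ 'q). gradient (\<lambda>y. f (x, y)) (fst z))"
    by (rule continuous_on_compose2[OF continuous_on_partial_gradient[OF f bounded_linear_ident]])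
       (auto intro!: continuous_intros)
  have dg: "continuous_on UNIV
      (\<lambda>z :: (real ^ 'm) \<times> (real ^ 'q). gradient (\<lambda>y. g (x, y) $ i) (fst z))" for i
    by (rule continuous_on_compose2[OF continuous_on_partial_gradient[OF g bounded_linear_vec_nth]])
       (auto intro!: continuous_intros)
  have gc: "continuous_on UNIV (\<lambda>z :: (real ^ 'm) \<times> (real ^ 'q). g (x, fst z))"
    by (rule continuous_on_compose2[OF twice_cont_diff_imp_continuous_on[OF g, of UNIV]])
       (auto intro!: continuous_intros)
  \<comment> \<open>The vector order is unfolded into components, so that each inequality compares
    continuous real functions.\<close>
  have "relaxed_KKT_set f g t x =
      {z. lagr_grad f g x (fst z) (snd z) = 0} \<inter> (\<Inter>i. {z. 0 \<le> snd z $ i}) \<inter>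
      (\<Inter>i. {z. g (x, fst z) $ i \<le> 0}) \<inter> (\<Inter>i. {z. - (snd z $ i) * (g (x, fst z) $ i) \<le> t})"
    unfolding relaxed_KKT_set_def by (auto simp: less_eq_vec_def)
  also have "closed \<dots>"
    unfolding lagr_grad_def
    by (intro closed_Int closed_INT ballI closed_Collect_eq closed_Collect_le continuous_intros
        df dg gc)
  finally show ?thesis .
qed

lemma relaxed_KKT_set_mono:
  assumes "s \<le> t"
  shows "relaxed_KKT_set f g s x \<subseteq> relaxed_KKT_set f g t x"
  unfolding relaxed_KKT_set_def by (auto intro: order_trans[OF _ assms])

lemma KKT_set_eq_INT_relaxed: "KKT_set f g x = (\<Inter>t\<in>{0<..}. relaxed_KKT_set f g t x)"
proof -
  have "(\<Inter>t\<in>{0<..}. relaxed_KKT_set f g t x) \<subseteq> relaxed_KKT_set f g 0 x"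
  proof
    fix z assume z: "z \<in> (\<Inter>t\<in>{0<..}. relaxed_KKT_set f g t x)"
    obtain y u where yu: "z = (y, u)"
      by (rule prod.exhaust)
    have mem: "(y, u) \<in> relaxed_KKT_set f g t x" if "t > 0" for t
      using z that unfolding yu by blast
    have "- (u $ i) * (g (x, y) $ i) \<le> t" if "t > 0" for i t
      using mem[OF that] unfolding relaxed_KKT_set_def by blast
    \<comment> \<open>The parameter \<open>t\<close> itself plays the part of epsilon.\<close>
    then have "- (u $ i) * (g (x, y) $ i) \<le> 0" for i
      by (rule field_le_epsilon[where y = 0, unfolded add_0_left])
    \<comment> \<open>The other conditions do not depend on \<open>t\<close> and are taken from
      \<open>t = 1\<close>.\<close>
    with mem[OF zero_less_one] show "z \<in> relaxed_KKT_set f g 0 x"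
      unfolding yu relaxed_KKT_set_def by blast
  qed
  then show ?thesis
    unfolding KKT_set_eq_relaxed_0 using relaxed_KKT_set_mono[OF less_imp_le, of 0] by blast
qed

text \<open>Each point of \<open>A\<close> competes in its own infimum, at distance 0.\<close>

lemma excess_eq_0_if_subset:
  assumes "A \<subseteq> B"
  shows "excess A B = 0"
proof -
  have "edist_set a B \<le> 0" if "a \<in> A" for a
    using assms that unfolding edist_set_def by (intro INF_lower2[of a]) auto
  then have "excess A B \<le> 0"
    unfolding excess_def by (rule SUP_least)
  then show ?thesis
    by simp
qed

text \<open>A cycle of inclusions: the upper limit lies in the intersection, the intersection in the
  lower limit, and the lower limit in the upper one.\<close>

lemma PK_converges_INT_if_mono:
  assumes closed: "\<And>t. t > 0 \<Longrightarrow> closed (\<Psi> t)"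
    and mono: "\<And>s t. 0 < s \<Longrightarrow> s \<le> t \<Longrightarrow> \<Psi> s \<subseteq> \<Psi> t"
  shows "PK_converges \<Psi> (\<Inter>t\<in>{0<..}. \<Psi> t)"
proof -
  have "z \<in> \<Psi> s" if z: "z \<in> PK_limsup \<Psi>" and s: "s > 0" for z s
  proof -
    obtain t zs where t: "down_to_zero t" and zs: "zs \<longlonglongrightarrow> z" "\<And>k. zs k \<in> \<Psi> (t k)"
      using z unfolding PK_limsup_def by blast
    \<comment> \<open>For fixed \<open>s\<close>, monotonicity puts a tail of \<open>zs\<close> into
      the closed set \<open>\<Psi> s\<close>, which therefore contains the limit.\<close>
    have "\<forall>\<^sub>F k in sequentially. t k < s"
      using t s unfolding down_to_zero_def by (auto intro: order_tendstoD)
    then have "\<forall>\<^sub>F k in sequentially. zs k \<in> \<Psi> s"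
    proof (rule eventually_mono)
      fix k assume "t k < s"
      then show "zs k \<in> \<Psi> s"
        using t zs(2)[of k] mono[of "t k" s] unfolding down_to_zero_def by auto
    qed
    with closed[OF s] show ?thesis
      using zs(1) by (intro Lim_in_closed_set[of "\<Psi> s" zs sequentially z]) auto
  qed
  moreover have "PK_liminf \<Psi> \<subseteq> PK_limsup \<Psi>"
  proof -
    \<comment> \<open>One concrete admissible sequence turns the universal quantifier of the lower
      limit into the existential one of the upper limit.\<close>
    have "down_to_zero (\<lambda>k. inverse (real (Suc k)))"
      unfolding down_to_zero_def using LIMSEQ_inverse_real_of_nat by simp
    then show ?thesis
      unfolding PK_liminf_def PK_limsup_def by blast
  qed
  \<comment> \<open>The witness is the constant sequence at the given point.\<close>
  moreover have "(\<Inter>t\<in>{0<..}. \<Psi> t) \<subseteq> PK_liminf \<Psi>"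
    unfolding PK_liminf_def down_to_zero_def by (auto intro!: exI tendsto_const)
  ultimately show ?thesis
    unfolding PK_converges_def by blast
qed

theorem proposition2p1:
  fixes F f :: "(real ^ 'n) \<times> (real ^ 'm) \<Rightarrow> real"
    and G :: "real ^ 'n \<Rightarrow> real ^ 'p"
    and g :: "(real ^ 'n) \<times> (real ^ 'm) \<Rightarrow> real ^ 'q"
  assumes "twice_cont_diff F" and "twice_cont_diff f"
    and "twice_cont_diff G" and "twice_cont_diff g"
    and "\<forall>x. x \<in> upper_feasible G \<longrightarrow> lower_sol f g x \<noteq> {}"
    and "\<forall>x. x \<notin> upper_feasible G \<longrightarrow> lower_sol f g x = {}"
    and "\<forall>x. convex_on UNIV (\<lambda>y. f (x, y))"
    and "\<forall>x i. convex_on UNIV (\<lambda>y. g (x, y) $ i)"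
    and "\<forall>x\<in>upper_feasible G. \<exists>y. \<forall>i. g (x, y) $ i < 0"
    and "\<forall>x\<in>upper_feasible G. \<forall>t>0. relaxed_KKT_set f g t x \<noteq> {}"
  shows "\<forall>x.
     (closed (KKT_set f g x) \<and> (\<forall>t>0. closed (relaxed_KKT_set f g t x))) \<and>
     (\<forall>t1 t2. t2 > t1 \<and> t1 > 0 \<longrightarrow> relaxed_KKT_set f g t1 x \<subseteq> relaxed_KKT_set f g t2 x) \<and>
     (KKT_set f g x = (\<Inter>t\<in>{0<..}. relaxed_KKT_set f g t x) \<and>
      (\<forall>t>0. excess (KKT_set f g x) (relaxed_KKT_set f g t x) = 0 \<and>
             psi_p F f g x \<le> psi_p_relaxed F f g t x)) \<and>
     PK_converges (\<lambda>t. relaxed_KKT_set f g t x) (KKT_set f g x)"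
proof
  fix x
  have closed: "closed (relaxed_KKT_set f g t x)" for t
    using assms(2,4) by (rule closed_relaxed_KKT_set)
  have sub: "KKT_set f g x \<subseteq> relaxed_KKT_set f g t x" if "t > 0" for t
    using that unfolding KKT_set_eq_relaxed_0 by (intro relaxed_KKT_set_mono) simp
  have "excess (KKT_set f g x) (relaxed_KKT_set f g t x) = 0 \<and>
      psi_p F f g x \<le> psi_p_relaxed F f g t x" if "t > 0" for t
    \<comment> \<open>Both values are suprema in \<open>ereal\<close>, so set inclusion alone
      compares them, even when they are infinite.\<close>
    unfolding psi_p_def psi_p_relaxed_def
    using sub[OF that] by (blast intro: excess_eq_0_if_subset SUP_subset_mono)
  moreover have "closed (KKT_set f g x)"
    unfolding KKT_set_eq_relaxed_0 by (rule closed)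
  moreover have "PK_converges (\<lambda>t. relaxed_KKT_set f g t x) (KKT_set f g x)"
    unfolding KKT_set_eq_INT_relaxed using closed relaxed_KKT_set_mono
    by (rule PK_converges_INT_if_mono)
  ultimately show
    "(closed (KKT_set f g x) \<and> (\<forall>t>0. closed (relaxed_KKT_set f g t x))) \<and>
     (\<forall>t1 t2. t2 > t1 \<and> t1 > 0 \<longrightarrow> relaxed_KKT_set f g t1 x \<subseteq> relaxed_KKT_set f g t2 x) \<and>
     (KKT_set f g x = (\<Inter>t\<in>{0<..}. relaxed_KKT_set f g t x) \<and>
      (\<forall>t>0. excess (KKT_set f g x) (relaxed_KKT_set f g t x) = 0 \<and>
             psi_p F f g x \<le> psi_p_relaxed F f g t x)) \<and>
     PK_converges (\<lambda>t. relaxed_KKT_set f g t x) (KKT_set f g x)"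
    using closed relaxed_KKT_set_mono[OF less_imp_le] KKT_set_eq_INT_relaxed by blast
qed

end
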